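(* Let $\mathcal{N}\subset\mathbb{R}^j$ be a $C^2$ submanifold without boundary. For $x\in\mathbb{R}^j$ let $\rho(x)=d(x,\mathcal{N})=\inf_{y\in\mathcal{N}}\|x-y\|$, and let $\alpha(x)=1/\rho(x)^2$. Let $\mathcal{U}$ be the largest open set in $\mathbb{R}^j$ such that, for any $x\in\mathcal{U}$, there is a unique closest point in $\mathcal{N}$ to $x$. Then the function $\alpha:\mathcal{U}\setminus\mathcal{N}\to\mathbb{R}$ is self-convex.
   Context: $\|\cdot\|$ is the Euclidean norm on $\mathbb{R}^j$, and $\mathcal{U}\setminus\mathcal{N}$ carries the Euclidean metric. Self-convexity: let $(\mathcal{M},\langle\cdot,\cdot\rangle)$ be a Riemannian manifold and $\alpha:\mathcal{M}\to\mathbb{R}$ a $C^2$ function with positive values. Let $\mathcal{M}_\kappa$ be $\mathcal{M}$ with the new metric $\langle\cdot,\cdot\rangle_{\kappa,x}=\alpha(x)\langle\cdot,\cdot\rangle_x$. The function $\alpha$ is self-convex when $t\mapsto\log\alpha(\gamma(t))$ is convex for every geodesic $\gamma$ in $\mathcal{M}_\kappa$. *)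

theory Defs
  imports "HOL-Analysis.Analysis"
begin

text \<open>Twice continuous Frechet differentiability; meant for open \<open>S\<close>.\<close>

definition C2_on :: "'a::real_normed_vector set \<Rightarrow> ('a \<Rightarrow> 'b::real_normed_vector) \<Rightarrow> bool" where
  "C2_on S f \<longleftrightarrow>
    (\<exists>(f' :: 'a \<Rightarrow> 'a \<Rightarrow>\<^sub>L 'b) (f'' :: 'a \<Rightarrow> 'a \<Rightarrow>\<^sub>L 'a \<Rightarrow>\<^sub>L 'b).
      (\<forall>x\<in>S. (f has_derivative blinfun_apply (f' x)) (at x)) \<and>
      (\<forall>x\<in>S. (f' has_derivative blinfun_apply (f'' x)) (at x)) \<and>
      continuous_on S f'')"

definition C2_diffeomorphism ::
    "'a::real_normed_vector set \<Rightarrow> 'b::real_normed_vector set \<Rightarrow> ('a \<Rightarrow> 'b) \<Rightarrow> ('b \<Rightarrow> 'a) \<Rightarrow> bool" where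
  "C2_diffeomorphism V W \<phi> \<psi> \<longleftrightarrow>
    open V \<and> open W \<and> homeomorphism V W \<phi> \<psi> \<and> C2_on V \<phi> \<and> C2_on W \<psi>"

text \<open>Embedded submanifolds of dimension \<open>k\<close> without boundary, given by flattening charts of the
  ambient space. They need not be closed, connected or nonempty.\<close>

definition C2_submanifold :: "nat \<Rightarrow> 'a::euclidean_space set \<Rightarrow> bool" where
  "C2_submanifold k N \<longleftrightarrow>
    (\<forall>p\<in>N. \<exists>V W \<phi> \<psi> (L :: 'a set).
      p \<in> V \<and> C2_diffeomorphism V W \<phi> \<psi> \<and> subspace L \<and> dim L = k \<and> \<phi> ` (N \<inter> V) = L \<inter> W)"

text \<open>Riemannian metrics on an open subset \<open>S\<close> of a Euclidean space, all tangent spaces being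
  identified with the space itself; \<open>g x u v\<close> is the product of \<open>u\<close> and \<open>v\<close> at \<open>x\<close>.\<close>

definition riemannian_metric_on :: "'a::euclidean_space set \<Rightarrow> ('a \<Rightarrow> 'a \<Rightarrow> 'a \<Rightarrow> real) \<Rightarrow> bool" where
  "riemannian_metric_on S g \<longleftrightarrow>
    (\<forall>x\<in>S. bilinear (g x) \<and> (\<forall>u v. g x u v = g x v u) \<and> (\<forall>u. u \<noteq> 0 \<longrightarrow> 0 < g x u u)) \<and>
    (\<forall>u v. C2_on S (\<lambda>x. g x u v))"

text \<open>Christoffel symbols of the first kind: the value is \<open>g x (\<Gamma> u v) w\<close>, where \<open>\<Gamma> u v\<close> is the
  Levi-Civita derivative at \<open>x\<close> of the constant vector field \<open>v\<close> in direction \<open>u\<close>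
  (Koszul formula).\<close>

definition christoffel_first ::
    "('a::euclidean_space \<Rightarrow> 'a \<Rightarrow> 'a \<Rightarrow> real) \<Rightarrow> 'a \<Rightarrow> 'a \<Rightarrow> 'a \<Rightarrow> 'a \<Rightarrow> real" where
  "christoffel_first g x u v w =
    (frechet_derivative (\<lambda>y. g y v w) (at x) u
      + frechet_derivative (\<lambda>y. g y u w) (at x) v
      - frechet_derivative (\<lambda>y. g y u v) (at x) w) / 2"

text \<open>The geodesic equation \<open>\<gamma>'' + \<Gamma> \<gamma>' \<gamma>' = 0\<close>, paired with an arbitrary vector \<open>w\<close>. The interval
  \<open>I\<close> may be open, closed or half-open; derivatives at its endpoints are one-sided.\<close>

definition geodesic_on ::
    "'a::euclidean_space set \<Rightarrow> ('a \<Rightarrow> 'a \<Rightarrow> 'a \<Rightarrow> real) \<Rightarrow> real set \<Rightarrow> (real \<Rightarrow> 'a) \<Rightarrow> bool" where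
  "geodesic_on S g I \<gamma> \<longleftrightarrow>
    is_interval I \<and> \<gamma> ` I \<subseteq> S \<and>
    (\<exists>\<gamma>' \<gamma>''. \<forall>t\<in>I.
      (\<gamma> has_vector_derivative \<gamma>' t) (at t within I) \<and>
      (\<gamma>' has_vector_derivative \<gamma>'' t) (at t within I) \<and>
      (\<forall>w. g (\<gamma> t) (\<gamma>'' t) w + christoffel_first g (\<gamma> t) (\<gamma>' t) (\<gamma>' t) w = 0))"

text \<open>The standing assumptions on the manifold \<open>(S, g)\<close> and on \<open>\<alpha>\<close> are part of the notion.\<close>

definition self_convex ::
    "'a::euclidean_space set \<Rightarrow> ('a \<Rightarrow> 'a \<Rightarrow> 'a \<Rightarrow> real) \<Rightarrow> ('a \<Rightarrow> real) \<Rightarrow> bool" where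
  "self_convex S g \<alpha> \<longleftrightarrow>
    open S \<and> riemannian_metric_on S g \<and> C2_on S \<alpha> \<and> (\<forall>x\<in>S. 0 < \<alpha> x) \<and>
    (\<forall>I \<gamma>. geodesic_on S (\<lambda>x u v. \<alpha> x * g x u v) I \<gamma> \<longrightarrow> convex_on I (\<lambda>t. ln (\<alpha> (\<gamma> t))))"

definition closest_point_in :: "'a::metric_space set \<Rightarrow> 'a \<Rightarrow> 'a \<Rightarrow> bool" where
  "closest_point_in N x y \<longleftrightarrow> y \<in> N \<and> (\<forall>z\<in>N. dist x y \<le> dist x z)"

definition unique_closest_domain :: "'a::metric_space set \<Rightarrow> 'a set" where
  "unique_closest_domain N = \<Union>{V. open V \<and> (\<forall>x\<in>V. \<exists>!y. closest_point_in N x y)}"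

lemma unique_closest_domain_greatest:
  "open (unique_closest_domain N)"
  "x \<in> unique_closest_domain N \<Longrightarrow> \<exists>!y. closest_point_in N x y"
  "open V \<Longrightarrow> (\<And>x. x \<in> V \<Longrightarrow> \<exists>!y. closest_point_in N x y) \<Longrightarrow> V \<subseteq> unique_closest_domain N"
proof -
  show "open (unique_closest_domain N)"
    unfolding unique_closest_domain_def by (rule open_Union) simp
  show "\<exists>!y. closest_point_in N x y" if x: "x \<in> unique_closest_domain N"
  proof -
    from x obtain V where "x \<in> V" "\<forall>x\<in>V. \<exists>!y. closest_point_in N x y"
      unfolding unique_closest_domain_def by (elim UnionE CollectE conjE)
    then show ?thesis by (rule bspec[rotated])
  qed
  show "V \<subseteq> unique_closest_domain N"
    if "open V" "\<And>x. x \<in> V \<Longrightarrow> \<exists>!y. closest_point_in N x y"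
    unfolding unique_closest_domain_def by (rule Union_upper) (simp add: that)
qed

end

theory Submission
  imports Defs
begin

text \<open>
  Write \<open>p x\<close> for the nearest point of \<open>N\<close> to \<open>x\<close>, \<open>f\<close> for
  the squared distance to \<open>N\<close>, and \<open>z x = x - p x\<close>. On the domain of unique
  nearest points \<open>f\<close> has the gradient \<open>2 z\<close>, and
  \<open>f = z \<bullet> z\<close>. For a geodesic \<open>\<gamma>\<close> of the metric
  \<open>(1 / f) (u \<bullet> v)\<close>, the geodesic equation paired with \<open>z\<close> turns the
  second derivative of \<open>ln (1 / f (\<gamma> t))\<close> into
  \<open>2 (Dp \<gamma>' \<bullet> \<gamma>') / f\<close>
  (\<open>convex_along_conformal_geodesic\<close>). This is nonnegative because \<open>p\<close> is monotone
  (\<open>nearest_monotone\<close>): \<open>p\<close> is the gradient of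
  \<open>((norm x)\<^sup>2 - f x) / 2\<close>, the supremum over \<open>y \<in> N\<close> of the affine
  functions \<open>x \<bullet> y - (norm y)\<^sup>2 / 2\<close>.

  This argument needs \<open>p\<close> to be continuously differentiable off \<open>N\<close>, which is the
  harder part. In a chart of \<open>N\<close> the nearest point solves a critical point equation, and it depends
  smoothly on \<open>x\<close> when the Hessian of the squared distance on \<open>N\<close> is positive
  definite, that is, when \<open>x\<close> is not a focal point (\<open>nearest_locally_C1\<close>). Focal
  points are excluded by the openness of the domain: \<open>p x\<close> remains a closest point for some points
  beyond \<open>x\<close> on the ray from \<open>p x\<close> through \<open>x\<close>
  (\<open>nearest_of_beyond\<close>, by Brouwer's fixed point theorem), whereas a minimiser that survives moving
  further out has a positive definite Hessian before. The submanifold need not be closed; openness of the domain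
  also keeps its missing limit points from being closest (\<open>closest_in_closure_is_nearest\<close>), from
  which the continuity of \<open>p\<close> follows.
\<close>

section \<open>The nearest point map\<close>

definition nearest :: "'a::metric_space set \<Rightarrow> 'a \<Rightarrow> 'a" where
  "nearest N x = (THE y. closest_point_in N x y)"

lemma closest_point_in_infdist:
  assumes "closest_point_in N x y"
  shows "infdist x N = dist x y"
proof (rule antisym)
  show "infdist x N \<le> dist x y"
    using assms by (simp add: closest_point_in_def infdist_le)
  have "N \<noteq> {}"
    using assms by (auto simp: closest_point_in_def)
  then show "dist x y \<le> infdist x N"
    unfolding infdist_notempty[OF \<open>N \<noteq> {}\<close>]
    using assms by (intro cINF_greatest) (auto simp: closest_point_in_def)
qed

lemma closest_point_in_nearest:
  assumes "x \<in> unique_closest_domain N"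
  shows "closest_point_in N x (nearest N x)"
  unfolding nearest_def by (rule theI'[OF unique_closest_domain_greatest(2)[OF assms]])

lemma nearest_eqI:
  assumes "x \<in> unique_closest_domain N" "closest_point_in N x y"
  shows "nearest N x = y"
  using unique_closest_domain_greatest(2)[OF assms(1)] closest_point_in_nearest[OF assms(1)] assms(2)
  by blast

lemma nearest_in: "x \<in> unique_closest_domain N \<Longrightarrow> nearest N x \<in> N"
  using closest_point_in_nearest closest_point_in_def by blast

lemma dist_nearest: "x \<in> unique_closest_domain N \<Longrightarrow> dist x (nearest N x) = infdist x N"
  using closest_point_in_nearest closest_point_in_infdist by fastforce

lemma dist_nearest_le:
  "x \<in> unique_closest_domain N \<Longrightarrow> z \<in> N \<Longrightarrow> dist x (nearest N x) \<le> dist x z"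
  using closest_point_in_nearest closest_point_in_def by blast

text \<open>For \<open>z\<close> between \<open>y\<close> and \<open>x\<close>, the closed ball about \<open>z\<close>
  through \<open>y\<close> lies inside the ball about \<open>x\<close> through \<open>y\<close> and touches its
  boundary only at \<open>y\<close>.\<close>

lemma closest_from_inner_point_unique:
  fixes x y q :: "'a::real_inner"
  assumes "dist x y \<le> dist x q" "dist z q \<le> dist z y"
    and z: "z = y + c *\<^sub>R (x - y)" and c: "0 \<le> c" "c < 1"
  shows "q = y"
proof -
  define a p where "a = x - y" and "p = q - y"
  have "(norm a)\<^sup>2 \<le> (norm (a - p))\<^sup>2"
    using assms(1) unfolding a_def p_def dist_norm by (simp add: algebra_simps)
  then have 1: "2 * (a \<bullet> p) \<le> p \<bullet> p"
    by (simp add: power2_norm_eq_inner algebra_simps inner_commute)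
  have "norm (c *\<^sub>R a - p) \<le> norm (c *\<^sub>R a)"
    using assms(2) unfolding a_def p_def dist_norm z by (simp add: algebra_simps)
  then have "(norm (c *\<^sub>R a - p))\<^sup>2 \<le> (norm (c *\<^sub>R a))\<^sup>2"
    by simp
  then have 2: "p \<bullet> p \<le> c * (2 * (a \<bullet> p))"
    unfolding power2_norm_eq_inner by (simp add: algebra_simps inner_commute)
  have "c * (2 * (a \<bullet> p)) \<le> c * (p \<bullet> p)"
    using 1 c by (intro mult_left_mono) auto
  with 2 have "(1 - c) * (p \<bullet> p) \<le> 0"
    by (simp add: algebra_simps)
  then have "p \<bullet> p \<le> 0"
    using c by (simp add: mult_le_0_iff)
  then have "p = 0"
    using inner_ge_zero[of p] inner_eq_zero_iff[of p] by linarith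
  then show ?thesis
    by (simp add: p_def)
qed

text \<open>Although \<open>N\<close> need not be closed, no limit point of \<open>N\<close> outside \<open>N\<close>
  competes with the nearest point: if \<open>y\<close> were one, move \<open>x\<close> slightly towards
  \<open>y\<close>, to a point \<open>z\<close> that is still in the open domain. Only \<open>y\<close> can be
  closest to \<open>z\<close>, so \<open>y\<close> belongs to \<open>N\<close> after all.\<close>

lemma closest_in_closure_is_nearest:
  fixes N :: "'a::euclidean_space set"
  assumes x: "x \<in> unique_closest_domain N" and y: "y \<in> closure N" "dist x y = infdist x N"
  shows "y = nearest N x"
proof -
  let ?U = "unique_closest_domain N"
  have le: "dist x y \<le> dist x q" if "q \<in> N" for q
    using that y(2) infdist_le by metis
  have "((\<lambda>c. y + c *\<^sub>R (x - y)) \<longlongrightarrow> y + 1 *\<^sub>R (x - y)) (at_left (1::real))"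
    by (intro tendsto_intros)
  then have "\<forall>\<^sub>F c in at_left (1::real). y + c *\<^sub>R (x - y) \<in> ?U"
    using x by (intro topological_tendstoD[OF _ unique_closest_domain_greatest(1)]) auto
  moreover have "\<forall>\<^sub>F c in at_left (1::real). c \<in> {0<..<1}"
    by (rule eventually_at_left_real) simp
  ultimately obtain c where zU: "y + c *\<^sub>R (x - y) \<in> ?U" and c: "0 < c" "c < 1"
    using eventually_happens'[OF trivial_limit_at_left_real eventually_conj] by fastforce
  define z where "z = y + c *\<^sub>R (x - y)"
  have z: "z \<in> ?U"
    using zU by (simp add: z_def)
  have "infdist z N \<le> dist z y"
    using infdist_triangle[of z N y] y(1) in_closure_iff_infdist_zero[of N y] by (cases "N = {}") auto
  then have "dist z (nearest N z) \<le> dist z y"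
    by (simp add: dist_nearest[OF z])
  then have "nearest N z = y"
    by (rule closest_from_inner_point_unique[OF le[OF nearest_in[OF z]] _ z_def]) (use c in auto)
  then have "y \<in> N"
    using nearest_in[OF z] by simp
  then show ?thesis
    using le by (intro nearest_eqI[OF x, symmetric]) (simp add: closest_point_in_def)
qed

lemma unique_closest_domain_Diff_closure:
  fixes N :: "'a::euclidean_space set"
  shows "unique_closest_domain N - N = unique_closest_domain N - closure N"
proof -
  have "x \<in> N" if x: "x \<in> unique_closest_domain N" "x \<in> closure N" for x
  proof -
    have "N \<noteq> {}"
      using x(2) by auto
    then have "infdist x N = 0"
      using x(2) in_closure_iff_infdist_zero by blast
    then have "x = nearest N x"
      using x by (intro closest_in_closure_is_nearest) auto
    then show ?thesis
      using nearest_in[OF x(1)] by simp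
  qed
  then show ?thesis
    using closure_subset by blast
qed

lemma open_unique_closest_domain_Diff:
  fixes N :: "'a::euclidean_space set"
  shows "open (unique_closest_domain N - N)"
  unfolding unique_closest_domain_Diff_closure
  by (intro open_Diff unique_closest_domain_greatest closed_closure)

text \<open>Outside a ball about the nearest point of \<open>x\<close>, the closure of \<open>N\<close> stays at a distance
  \<open>m\<close> from \<open>x\<close> that exceeds the minimal one, by compactness; for points near
  \<open>x\<close> the nearest point cannot lie there.\<close>

lemma continuous_on_nearest:
  fixes N :: "'a::euclidean_space set"
  shows "continuous_on (unique_closest_domain N) (nearest N)"
  unfolding continuous_on_iff
proof (intro ballI allI impI)
  let ?U = "unique_closest_domain N"
  fix x and e :: real
  assume x: "x \<in> ?U" and e: "0 < e"
  define K where "K = (closure N \<inter> cball x (infdist x N + 2)) - ball (nearest N x) e"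
  have "compact K"
    unfolding K_def by (intro compact_diff closed_Int_compact) auto
  obtain m where m: "m > infdist x N" "\<And>q. q \<in> K \<Longrightarrow> m \<le> dist x q"
  proof (cases "K = {}")
    case True
    then show ?thesis
      using that[of "infdist x N + 1"] by simp
  next
    case False
    have "continuous_on K (dist x)"
      by (intro continuous_intros)
    then obtain q where q: "q \<in> K" "\<And>p. p \<in> K \<Longrightarrow> dist x q \<le> dist x p"
      using continuous_attains_inf[OF \<open>compact K\<close> False] by blast
    have qN: "q \<in> closure N" "q \<noteq> nearest N x"
      using q(1) e by (auto simp: K_def)
    have "N \<noteq> {}"
      using nearest_in[OF x] by auto
    then have "infdist q N = 0"
      using qN(1) in_closure_iff_infdist_zero by blast
    then have "infdist x N \<le> dist x q"
      using infdist_triangle[of x N q] by simp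
    moreover have "dist x q \<noteq> infdist x N"
      using closest_in_closure_is_nearest[OF x qN(1)] qN(2) by blast
    ultimately show ?thesis
      using that[of "dist x q"] q(2) by simp
  qed
  define d where "d = min 1 ((m - infdist x N) / 2)"
  have "d > 0"
    using m(1) by (simp add: d_def)
  moreover have "dist (nearest N x') (nearest N x) < e" if x': "x' \<in> ?U" "dist x' x < d" for x'
  proof -
    have "dist x (nearest N x') \<le> dist x x' + infdist x' N"
      using dist_triangle[of x "nearest N x'" x'] dist_nearest[OF x'(1)] by simp
    also have "\<dots> \<le> 2 * dist x x' + infdist x N"
      using infdist_triangle[of x' N x] by (simp add: dist_commute)
    finally have *: "dist x (nearest N x') \<le> 2 * dist x' x + infdist x N"
      by (simp add: dist_commute)
    have "dist x' x < 1" "dist x' x < (m - infdist x N) / 2"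
      using x'(2) by (simp_all add: d_def)
    then have "2 * dist x' x < m - infdist x N" "2 * dist x' x < 2"
      by auto
    with * have "dist x (nearest N x') < m" "dist x (nearest N x') \<le> infdist x N + 2"
      by auto
    then have "nearest N x' \<notin> K"
      using m(2) by force
    moreover have "nearest N x' \<in> closure N \<inter> cball x (infdist x N + 2)"
      using nearest_in[OF x'(1)] \<open>dist x (nearest N x') \<le> infdist x N + 2\<close> closure_subset by auto
    ultimately show ?thesis
      by (auto simp: K_def dist_commute)
  qed
  ultimately show "\<exists>d>0. \<forall>x'\<in>?U. dist x' x < d \<longrightarrow> dist (nearest N x') (nearest N x) < e"
    by blast
qed

text \<open>Let \<open>T z\<close> be the point of the sphere of radius \<open>r\<close> about \<open>x\<close> that is
  reached from \<open>x\<close> by moving away from the nearest point of \<open>z\<close>. A fixed point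
  \<open>z\<close> of \<open>T\<close>, which Brouwer's theorem provides, has \<open>x\<close> on the segment
  from \<open>z\<close> to its nearest point \<open>y\<close>; then \<open>y\<close> is also the nearest point
  of \<open>x\<close>, and it is closest to \<open>z\<close>, a point beyond \<open>x\<close> on the ray from
  \<open>y\<close>.\<close>

lemma nearest_of_beyond:
  fixes N :: "'a::euclidean_space set"
  assumes x: "x \<in> unique_closest_domain N - N"
  obtains s where "1 < s" "closest_point_in N (nearest N x + s *\<^sub>R (x - nearest N x)) (nearest N x)"
proof -
  let ?U = "unique_closest_domain N"
  obtain r where r: "0 < r" "cball x r \<subseteq> ?U"
    using x unique_closest_domain_greatest(1) open_contains_cball_eq by blast
  define T where "T z = x + (r / norm (x - nearest N z)) *\<^sub>R (x - nearest N z)" for z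
  have ne: "norm (x - nearest N z) \<noteq> 0" if "z \<in> cball x r" for z
    using nearest_in[of z N] r(2) that x by auto
  have cont: "continuous_on (cball x r) (nearest N)"
    using continuous_on_nearest r(2) continuous_on_subset by blast
  have "continuous_on (cball x r) T"
    unfolding T_def using ne by (intro continuous_intros cont) auto
  moreover have "T \<in> cball x r \<rightarrow> cball x r"
    using ne r(1) by (auto simp: T_def dist_norm)
  ultimately obtain z where z: "z \<in> cball x r" "T z = z"
    using brouwer_ball[OF r(1)] by blast
  define k where "k = r / norm (x - nearest N z)"
  have k: "k > 0"
    using ne[OF z(1)] r(1) by (simp add: k_def)
  let ?y = "nearest N z"
  have zU: "z \<in> ?U"
    using z r by auto
  have z_eq: "z = ?y + (1 + k) *\<^sub>R (x - ?y)"
    using z(2) unfolding T_def k_def by (simp add: algebra_simps)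
  have "z - ?y = (1 + k) *\<^sub>R (x - ?y)"
    using z_eq by (metis add_diff_cancel_left')
  then have "(1 / (1 + k)) *\<^sub>R (z - ?y) = x - ?y"
    using k by simp
  then have x_eq: "x = ?y + (1 / (1 + k)) *\<^sub>R (z - ?y)"
    by simp
  have "dist z ?y \<le> dist z (nearest N x)" "dist x (nearest N x) \<le> dist x ?y"
    using x dist_nearest_le[OF zU nearest_in[of x]] dist_nearest_le[of x N ?y] nearest_in[OF zU]
    by auto
  then have "nearest N x = ?y"
    by (rule closest_from_inner_point_unique[OF _ _ x_eq]) (use k in auto)
  moreover have "closest_point_in N (?y + (1 + k) *\<^sub>R (x - ?y)) ?y"
    using closest_point_in_nearest[OF zU] unfolding z_eq[symmetric] .
  ultimately show thesis
    using that[of "1 + k"] k by simp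
qed

text \<open>The nearest point map is the gradient of the convex function
  \<open>x \<mapsto> (norm x)\<^sup>2 / 2 - (infdist x N)\<^sup>2 / 2\<close>, a supremum of affine
  functions; this is its monotonicity.\<close>

lemma nearest_monotone:
  fixes N :: "'a::euclidean_space set"
  assumes "x \<in> unique_closest_domain N" "y \<in> unique_closest_domain N"
  shows "0 \<le> (x - y) \<bullet> (nearest N x - nearest N y)"
proof -
  have "(norm (x - nearest N x))\<^sup>2 \<le> (norm (x - nearest N y))\<^sup>2"
       "(norm (y - nearest N y))\<^sup>2 \<le> (norm (y - nearest N x))\<^sup>2"
    using dist_nearest_le[OF assms(1) nearest_in[OF assms(2)]] 
      dist_nearest_le[OF assms(2) nearest_in[OF assms(1)]] by (auto simp: dist_norm)
  then show ?thesis
    unfolding power2_norm_eq_inner by (simp add: algebra_simps inner_commute)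
qed

text \<open>Testing the distance from \<open>y\<close> with the nearest point of \<open>x\<close>, and conversely, encloses
  the remainder between two quantities that are \<open>o(y - x)\<close> because the nearest point is
  continuous.\<close>

lemma has_derivative_infdist_power2:
  fixes N :: "'a::euclidean_space set"
  assumes x: "x \<in> unique_closest_domain N"
  shows "((\<lambda>x. (infdist x N)\<^sup>2) has_derivative (\<lambda>h. 2 * ((x - nearest N x) \<bullet> h))) (at x)"
proof -
  let ?U = "unique_closest_domain N" and ?p = "nearest N"
  define err where "err y = (infdist y N)\<^sup>2 - (infdist x N)\<^sup>2 - 2 * ((x - ?p x) \<bullet> (y - x))" for y
  have sq: "(infdist y N)\<^sup>2 = (y - ?p y) \<bullet> (y - ?p y)" if "y \<in> ?U" for y
    using dist_nearest[OF that] by (metis dist_norm power2_norm_eq_inner)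
  have le: "(y - ?p y) \<bullet> (y - ?p y) \<le> (y - ?p z) \<bullet> (y - ?p z)" if "y \<in> ?U" "z \<in> ?U" for y z
    using dist_nearest_le[OF that(1) nearest_in[OF that(2)]] by (simp add: dist_norm norm_le)
  have bound: "\<bar>err y\<bar> \<le> norm (y - x) * (norm (y - x) + 2 * norm (?p y - ?p x))" if y: "y \<in> ?U" for y
  proof -
    define h d where "h = y - x" and "d = ?p y - ?p x"
    have "err y = (y - ?p y) \<bullet> (y - ?p y) - (y - ?p x) \<bullet> (y - ?p x) + h \<bullet> h"
      unfolding err_def sq[OF x] sq[OF y] h_def by (simp add: algebra_simps inner_commute)
    then have 1: "err y \<le> h \<bullet> h"
      using le[OF y x] by simp
    have "err y = (x - ?p y) \<bullet> (x - ?p y) - (x - ?p x) \<bullet> (x - ?p x) + h \<bullet> h - 2 * (h \<bullet> d)"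
      unfolding err_def sq[OF x] sq[OF y] h_def d_def by (simp add: algebra_simps inner_commute)
    then have 2: "h \<bullet> h - 2 * (h \<bullet> d) \<le> err y"
      using le[OF x y] by simp
    have "\<bar>h \<bullet> d\<bar> \<le> norm h * norm d"
      by (rule Cauchy_Schwarz_ineq2)
    moreover have "norm h * norm d \<ge> 0"
      by simp
    moreover have "h \<bullet> h = norm h * norm h"
      by (metis power2_eq_square power2_norm_eq_inner)
    ultimately have "\<bar>err y\<bar> \<le> norm h * norm h + 2 * (norm h * norm d)"
      using 1 2 by (smt (verit) mult_nonneg_nonneg norm_ge_zero)
    then show ?thesis
      by (simp add: h_def d_def algebra_simps)
  qed
  have "(?p \<longlongrightarrow> ?p x) (at x)"
    using continuous_on_nearest x unique_closest_domain_greatest(1)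
    by (metis continuous_on_eq_continuous_at isCont_def)
  then have "((\<lambda>y. norm (y - x) + 2 * norm (?p y - ?p x)) \<longlongrightarrow> norm (x - x) + 2 * norm (?p x - ?p x)) (at x)"
    by (intro tendsto_intros)
  then have lim: "((\<lambda>y. norm (y - x) + 2 * norm (?p y - ?p x)) \<longlongrightarrow> 0) (at x)"
    by simp
  have "\<forall>\<^sub>F y in at x. norm (err y / norm (y - x)) \<le> norm (y - x) + 2 * norm (?p y - ?p x)"
    using eventually_at_in_open[OF unique_closest_domain_greatest(1) x]
    by eventually_elim (use bound in \<open>simp add: divide_simps mult.commute\<close>)
  then have "((\<lambda>y. err y / norm (y - x)) \<longlongrightarrow> 0) (at x)"
    using lim by (rule Lim_null_comparison)
  then have "((\<lambda>y. norm (err y) / norm (y - x)) \<longlongrightarrow> 0) (at x)"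
    using tendsto_norm_zero by fastforce
  moreover have "bounded_linear (\<lambda>h. 2 * ((x - ?p x) \<bullet> h))"
    by (intro bounded_linear_const_mult bounded_linear_inner_right)
  ultimately show ?thesis
    unfolding has_derivative_iff_norm err_def by simp
qed

section \<open>Implicit differentiation\<close>

text \<open>The part of the implicit function theorem that remains when a continuous solution \<open>u\<close> of
  \<open>G (y, u y) = 0\<close> is already given: invertibility of the partial derivative \<open>A\<close>
  makes \<open>u\<close> differentiable, by dividing the linearised equation
  \<open>B h + A k \<approx> 0\<close> by \<open>A\<close>.\<close>

lemma has_derivative_implicit:
  fixes G :: "'a::real_normed_vector \<times> 'b::euclidean_space \<Rightarrow> 'b" and u :: "'a \<Rightarrow> 'b"
    and A :: "'b \<Rightarrow>\<^sub>L 'b" and B :: "'a \<Rightarrow>\<^sub>L 'b"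
  assumes G: "(G has_derivative (\<lambda>p. B (fst p) + A (snd p))) (at (x, u x))"
    and u: "isCont u x" and G0: "\<forall>\<^sub>F y in at x. G (y, u y) = 0" "G (x, u x) = 0"
    and A: "\<And>w. A w = 0 \<Longrightarrow> w = 0"
  obtains D where "(u has_derivative blinfun_apply D) (at x)" "A o\<^sub>L D = - B"
proof -
  have linA: "linear A"
    by (simp add: blinfun.bounded_linear_right bounded_linear.linear)
  have "inj A"
    using A linear_injective_0[OF linA] by blast
  then obtain A' where A': "linear A'" "\<And>w. A (A' w) = w"
    using linear_injective_isomorphism[OF linA] by blast
  obtain c where c: "0 < c" "\<And>w. c * norm w \<le> norm (A w)"
    using linear_inj_bounded_below_pos[OF linA \<open>inj A\<close>] by blast
  define D where "D = - (Blinfun A' o\<^sub>L B)"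
  have D: "A (D h) = - B h" for h
    using A' by (simp add: D_def blinfun.bilinear_simps bounded_linear_Blinfun_apply linear_conv_bounded_linear)
  have "(u has_derivative D) (at x)"
    unfolding has_derivative_at_alt
  proof (intro conjI allI impI)
    show "bounded_linear D"
      by (rule blinfun.bounded_linear_right)
    fix e :: real
    assume e: "0 < e"
    (* The first bound absorbs the unknown part of the increment of u into the lower bound c of A;
       the second bounds what is left by e * norm (y - x). *)
    define \<epsilon> where "\<epsilon> = min (c / 2) (c / 2 * e / (1 + norm D))"
    have \<epsilon>: "0 < \<epsilon>" "\<epsilon> \<le> c / 2" "\<epsilon> * (1 + norm D) \<le> c / 2 * e"
    proof -
      have n: "0 < 1 + norm D"
        using norm_ge_zero[of D] by linarith
      then show "0 < \<epsilon>"
        using c(1) e by (simp add: \<epsilon>_def)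
      show "\<epsilon> \<le> c / 2"
        by (simp only: \<epsilon>_def min.cobounded1)
      have "\<epsilon> \<le> c / 2 * e / (1 + norm D)"
        by (simp add: \<epsilon>_def)
      then show "\<epsilon> * (1 + norm D) \<le> c / 2 * e"
        using n by (simp only: pos_le_divide_eq)
    qed
    have "\<forall>\<epsilon>>0. \<exists>d>0. \<forall>p. norm (p - (x, u x)) < d \<longrightarrow>
        norm (G p - G (x, u x) - (B (fst (p - (x, u x))) + A (snd (p - (x, u x)))))
          \<le> \<epsilon> * norm (p - (x, u x))"
      using G unfolding has_derivative_at_alt by blast
    then obtain d where d: "d > 0" "\<And>p. norm (p - (x, u x)) < d \<Longrightarrow>
        norm (G p - G (x, u x) - (B (fst (p - (x, u x))) + A (snd (p - (x, u x)))))
          \<le> \<epsilon> * norm (p - (x, u x))"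
      using \<epsilon>(1) by blast
    have near: "\<forall>\<^sub>F y in nhds x. norm (u y - u x) < d / 2"
      using tendstoD[OF u[unfolded isCont_def], of "d / 2"] d(1)
      by (simp add: eventually_nhds_conv_at dist_norm)
    moreover have "\<forall>\<^sub>F y in nhds x. norm (y - x) < d / 2"
      unfolding eventually_nhds_metric dist_norm using d(1) by (intro exI[of _ "d / 2"]) simp
    moreover have "\<forall>\<^sub>F y in nhds x. G (y, u y) = 0"
      using G0 by (simp add: eventually_nhds_conv_at)
    ultimately have "\<forall>\<^sub>F y in nhds x. norm (u y - u x - D (y - x)) \<le> e * norm (y - x)"
    proof eventually_elim
      case (elim y)
      define h k where "h = y - x" and "k = u y - u x"
      have p: "(y, u y) - (x, u x) = (h, k)"
        by (simp add: h_def k_def)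
      have nhk: "norm (h, k) \<le> norm h + norm k"
        by (rule norm_Pair_le)
      then have "norm ((y, u y) - (x, u x)) < d"
        unfolding p using elim(1,2) by (simp add: h_def k_def)
      from d(2)[OF this] have "norm (B h + A k) \<le> \<epsilon> * norm (h, k)"
        unfolding p using elim(3) G0(2) by (simp add: norm_minus_commute add.commute)
      also have "\<dots> \<le> \<epsilon> * (norm h + norm k)"
        using \<epsilon>(1) nhk by simp
      finally have 1: "norm (B h + A k) \<le> \<epsilon> * (norm h + norm k)" .
      have "norm k \<le> norm (k - D h) + norm (D h)"
        using norm_triangle_ineq[of "k - D h" "D h"] by simp
      also have "\<dots> \<le> norm (k - D h) + norm D * norm h"
        using norm_blinfun[of D h] by simp
      finally have 2: "\<epsilon> * (norm h + norm k) \<le> \<epsilon> * (norm h + (norm (k - D h) + norm D * norm h))"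
        using \<epsilon>(1) by simp
      have "c * norm (k - D h) \<le> norm (A (k - D h))"
        by (rule c(2))
      also have "A (k - D h) = B h + A k"
        using D by (simp add: blinfun.bilinear_simps)
      also note 1
      also note 2
      also have "\<epsilon> * (norm h + (norm (k - D h) + norm D * norm h))
          = \<epsilon> * norm (k - D h) + \<epsilon> * (1 + norm D) * norm h"
        by (simp add: algebra_simps)
      also have "\<dots> \<le> c / 2 * norm (k - D h) + c / 2 * e * norm h"
        using \<epsilon> by (intro add_mono mult_right_mono) auto
      finally have "c / 2 * norm (k - D h) \<le> c / 2 * (e * norm h)"
        by (simp add: algebra_simps)
      then have "norm (k - D h) \<le> e * norm h"
        using c(1) by simp
      then show ?case
        by (simp add: h_def k_def)
    qed
    then show "\<exists>d>0. \<forall>y. norm (y - x) < d \<longrightarrow> norm (u y - u x - D (y - x)) \<le> e * norm (y - x)"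
      by (simp add: eventually_nhds_metric dist_norm)
  qed
  moreover have "A o\<^sub>L D = - B"
    using D by (intro blinfun_eqI) (simp add: blinfun.bilinear_simps)
  ultimately show thesis
    using that by blast
qed

text \<open>This gives continuity of the derivative found by implicit differentiation. Each \<open>A x\<close> is bounded
  below by some \<open>c > 0\<close>, hence nearby \<open>A y\<close> by \<open>c / 2\<close>, and
  \<open>A y (D y - D x) = B y - A y (D x)\<close> tends to \<open>0\<close>.\<close>

lemma continuous_on_blinfun_quotient:
  fixes A :: "'x::topological_space \<Rightarrow> 'b::euclidean_space \<Rightarrow>\<^sub>L 'b"
    and B D :: "'x \<Rightarrow> 'a::real_normed_vector \<Rightarrow>\<^sub>L 'b"
  assumes A: "continuous_on X A" and B: "continuous_on X B"
    and inj: "\<And>x w. x \<in> X \<Longrightarrow> A x w = 0 \<Longrightarrow> w = 0"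
    and eq: "\<And>x. x \<in> X \<Longrightarrow> A x o\<^sub>L D x = B x"
  shows "continuous_on X D"
  unfolding continuous_on_def
proof
  fix x
  assume x: "x \<in> X"
  let ?F = "at x within X"
  have linA: "linear (A x)"
    by (simp add: blinfun.bounded_linear_right bounded_linear.linear)
  then have "inj (A x)"
    using inj[OF x] linear_injective_0[OF linA] by blast
  then obtain c where c: "0 < c" "\<And>w. c * norm w \<le> norm (A x w)"
    using linear_inj_bounded_below_pos[OF linA] by blast
  have tA: "(A \<longlongrightarrow> A x) ?F" and tB: "(B \<longlongrightarrow> B x) ?F"
    using A B x by (auto simp: continuous_on_def)
  have "((\<lambda>y. 2 / c * norm (B y - (A y o\<^sub>L D x))) \<longlongrightarrow> 2 / c * norm (B x - (A x o\<^sub>L D x))) ?F"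
    by (intro tendsto_intros tA tB)
  then have lim: "((\<lambda>y. 2 / c * norm (B y - (A y o\<^sub>L D x))) \<longlongrightarrow> 0) ?F"
    by (simp add: eq[OF x])
  have "\<forall>\<^sub>F y in ?F. dist (A y) (A x) < c / 2"
    using tA c(1) by (intro tendstoD) auto
  moreover have "\<forall>\<^sub>F y in ?F. y \<in> X"
    by (simp add: eventually_at_filter)
  ultimately have "\<forall>\<^sub>F y in ?F. norm (D y - D x) \<le> 2 / c * norm (B y - (A y o\<^sub>L D x))"
  proof eventually_elim
    case (elim y)
    have "norm ((D y - D x) h) \<le> (2 / c * norm (B y - (A y o\<^sub>L D x))) * norm h" for h
    proof -
      define w where "w = (D y - D x) h"
      have "c * norm w \<le> norm (A x w)"
        by (rule c(2))
      also have "\<dots> = norm (A y w - (A y - A x) w)"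
        by (simp add: blinfun.bilinear_simps)
      also have "\<dots> \<le> norm (A y w) + norm ((A y - A x) w)"
        by (rule norm_triangle_ineq4)
      also have "norm ((A y - A x) w) \<le> c / 2 * norm w"
        using norm_blinfun[of "A y - A x" w] elim(1) mult_right_mono[of "norm (A y - A x)" "c / 2" "norm w"]
        by (simp add: dist_norm)
      finally have "c / 2 * norm w \<le> norm (A y w)"
        by simp
      also have "A y w = (B y - (A y o\<^sub>L D x)) h"
        unfolding eq[OF elim(2), symmetric] by (simp add: w_def blinfun.bilinear_simps)
      also have "norm \<dots> \<le> norm (B y - (A y o\<^sub>L D x)) * norm h"
        by (rule norm_blinfun)
      finally show ?thesis
        using c(1) unfolding w_def by (simp add: field_simps)
    qed
    then show ?case
      using c(1) by (intro norm_blinfun_bound) auto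
  qed
  then have "((\<lambda>y. D y - D x) \<longlongrightarrow> 0) ?F"
    using lim by (rule Lim_null_comparison)
  then show "(D \<longlongrightarrow> D x) ?F"
    by (simp add: LIM_zero_iff)
qed

section \<open>Differentiability of the nearest point map\<close>

lemma local_min_second_derivative_nonneg:
  fixes q q' :: "real \<Rightarrow> real"
  assumes q: "\<forall>\<^sub>F s in nhds t. (q has_real_derivative q' s) (at s)"
    and q': "(q' has_real_derivative c) (at t)"
    and min: "\<forall>\<^sub>F s in nhds t. q t \<le> q s"
  shows "q' t = 0" "0 \<le> c"
proof -
  obtain d where d: "0 < d" "\<And>s. dist s t < d \<Longrightarrow> (q has_real_derivative q' s) (at s)"
    "\<And>s. dist s t < d \<Longrightarrow> q t \<le> q s"
    using eventually_conj[OF q min] unfolding eventually_nhds_metric by blast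
  show 0: "q' t = 0"
    using d by (intro DERIV_local_min[of q "q' t" t d]) (auto simp: dist_real_def abs_minus_commute)
  show "0 \<le> c"
  proof (rule ccontr)
    assume "\<not> 0 \<le> c"
    then obtain e where e: "0 < e" "\<And>h. 0 < h \<Longrightarrow> h < e \<Longrightarrow> q' (t + h) < q' t"
      using DERIV_neg_dec_right[OF q'] by auto
    define s where "s = t + min d e / 2"
    have s: "t < s" "s - t < d" "s - t < e"
      using d(1) e(1) by (auto simp: s_def min_def)
    obtain z where z: "t < z" "z < s" "q s - q t = (s - t) * q' z"
      using MVT2[OF s(1), of q q'] d(2) s by (auto simp: dist_real_def)
    have "q' z < 0"
      using e(2)[of "z - t"] z s 0 by simp
    then have "q s < q t"
      using z(3) s(1) by (smt (verit) mult_pos_neg)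
    moreover have "q t \<le> q s"
      using d(3)[of s] s by (simp add: dist_real_def)
    ultimately show False
      by simp
  qed
qed

text \<open>The squared distance from \<open>z\<close> to the points \<open>\<psi> (u + s w)\<close> has a local minimum
  at \<open>s = 0\<close>, since these points stay in \<open>N\<close> for small \<open>s\<close>. Its first
  derivative vanishes there and its second is nonnegative.\<close>

lemma closest_point_parametrized:
  fixes \<psi> :: "'b::real_normed_vector \<Rightarrow> 'a::real_inner"
    and \<psi>' :: "'b \<Rightarrow> 'b \<Rightarrow>\<^sub>L 'a" and \<psi>'' :: "'b \<Rightarrow> 'b \<Rightarrow>\<^sub>L 'b \<Rightarrow>\<^sub>L 'a"
  assumes W: "open W" and L: "subspace L"
    and \<psi>: "\<And>v. v \<in> W \<Longrightarrow> (\<psi> has_derivative \<psi>' v) (at v)"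
    and \<psi>': "\<And>v. v \<in> W \<Longrightarrow> (\<psi>' has_derivative \<psi>'' v) (at v)"
    and N: "\<And>v. v \<in> L \<inter> W \<Longrightarrow> \<psi> v \<in> N"
    and u: "u \<in> L \<inter> W" "closest_point_in N z (\<psi> u)" and w: "w \<in> L"
  shows "(z - \<psi> u) \<bullet> \<psi>' u w = 0"
    and "(z - \<psi> u) \<bullet> \<psi>'' u w w \<le> \<psi>' u w \<bullet> \<psi>' u w"
proof -
  define l where "l s = u + s *\<^sub>R w" for s :: real
  define q where "q s = (z - \<psi> (l s)) \<bullet> (z - \<psi> (l s)) / 2" for s
  define q' where "q' s = - ((z - \<psi> (l s)) \<bullet> \<psi>' (l s) w)" for s
  define c where "c = \<psi>' u w \<bullet> \<psi>' u w - (z - \<psi> u) \<bullet> \<psi>'' u w w"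
  have l0: "l 0 = u"
    by (simp add: l_def)
  have dl: "(l has_derivative (\<lambda>s. s *\<^sub>R w)) (at s)" for s
    unfolding l_def by (auto intro!: derivative_eq_intros)
  have "isCont l 0"
    using dl has_derivative_continuous by blast
  then have lW: "\<forall>\<^sub>F s in nhds 0. l s \<in> W"
    using W u(1) l0 unfolding continuous_at_open eventually_nhds by auto
  have d\<psi>: "((\<lambda>s. \<psi> (l s)) has_derivative (\<lambda>r. r *\<^sub>R \<psi>' (l s) w)) (at s)" if "l s \<in> W" for s
    using has_derivative_compose[OF dl \<psi>[OF that]] by (simp add: blinfun.bilinear_simps)
  have q: "(q has_real_derivative q' s) (at s)" if "l s \<in> W" for s
    unfolding q_def q'_def has_field_derivative_def
    by (rule derivative_eq_intros d\<psi>[OF that] refl)+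
       (auto simp: fun_eq_iff inner_commute field_simps)
  have "l 0 \<in> W"
    using u(1) l0 by simp
  have d\<psi>': "((\<lambda>s. \<psi>' (l s)) has_derivative (\<lambda>r. r *\<^sub>R \<psi>'' u w)) (at 0)"
    using has_derivative_compose[OF dl \<psi>'[OF \<open>l 0 \<in> W\<close>]] by (simp add: blinfun.bilinear_simps l0)
  have q': "(q' has_real_derivative c) (at 0)"
    unfolding q'_def has_field_derivative_def
    by (rule derivative_eq_intros d\<psi>[OF \<open>l 0 \<in> W\<close>] refl
          bounded_linear.has_derivative[OF blinfun.bounded_linear_left d\<psi>'])+
       (auto simp: fun_eq_iff c_def l0 inner_commute blinfun.bilinear_simps algebra_simps)
  have "\<forall>\<^sub>F s in nhds 0. (q has_real_derivative q' s) (at s)"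
    using lW by eventually_elim (rule q)
  moreover have "\<forall>\<^sub>F s in nhds 0. q 0 \<le> q s"
    using lW
  proof eventually_elim
    case (elim s)
    have "l s \<in> L"
      unfolding l_def using u(1) w L by (simp add: subspace_add subspace_mul)
    then have "\<psi> (l s) \<in> N"
      using N elim by blast
    then have "dist z (\<psi> u) \<le> dist z (\<psi> (l s))"
      using u(2) by (simp add: closest_point_in_def)
    then show ?case
      by (simp add: q_def l0 dist_norm norm_le)
  qed
  ultimately have "q' 0 = 0" "0 \<le> c"
    using local_min_second_derivative_nonneg q' by blast+
  then show "(z - \<psi> u) \<bullet> \<psi>' u w = 0" "(z - \<psi> u) \<bullet> \<psi>'' u w w \<le> \<psi>' u w \<bullet> \<psi>' u w"
    by (simp_all add: q'_def c_def l0)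
qed

text \<open>In a chart \<open>\<psi>\<close>, the parameter \<open>u x\<close> of the nearest point solves the critical
  point equation of \<open>v \<mapsto> (norm (x - \<psi> v))\<^sup>2 / 2\<close> on \<open>L\<close>.
  The Hessian at \<open>u x\<close> is
  \<open>(norm (\<psi>' w))\<^sup>2 - (x - \<psi>) \<bullet> \<psi>'' w w\<close>. Minimality at
  \<open>x\<close> alone only makes it nonnegative; minimality at a point beyond \<open>x\<close> still makes it
  nonnegative with the second term multiplied by some \<open>s > 1\<close>, so it is positive. Hence
  \<open>u\<close> can be differentiated implicitly, with a continuous derivative.\<close>

lemma nearest_locally_C1:
  fixes N :: "'a::euclidean_space set"
  assumes N: "C2_submanifold k N" and x0: "x0 \<in> unique_closest_domain N - N"
  obtains X D where "open X" "x0 \<in> X"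
    "\<And>x. x \<in> X \<Longrightarrow> (nearest N has_derivative blinfun_apply (D x)) (at x)" "continuous_on X D"
proof -
  let ?S = "unique_closest_domain N - N"
  let ?p = "nearest N"
  have "?p x0 \<in> N"
    using x0 nearest_in by blast
  then obtain V W \<phi> \<psi> and L :: "'a set" where V: "?p x0 \<in> V" and chart: "C2_diffeomorphism V W \<phi> \<psi>"
    and L: "subspace L" and NL: "\<phi> ` (N \<inter> V) = L \<inter> W"
    using N unfolding C2_submanifold_def by meson
  have open_VW: "open V" "open W" and hom: "homeomorphism V W \<phi> \<psi>"
    and C2: "C2_on V \<phi>" "C2_on W \<psi>"
    using chart by (auto simp: C2_diffeomorphism_def)
  obtain \<phi>' where \<phi>: "\<And>y. y \<in> V \<Longrightarrow> (\<phi> has_derivative blinfun_apply (\<phi>' y)) (at y)"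
    using C2(1) unfolding C2_on_def by meson
  obtain \<psi>' \<psi>'' where \<psi>: "\<And>v. v \<in> W \<Longrightarrow> (\<psi> has_derivative blinfun_apply (\<psi>' v)) (at v)"
    and \<psi>': "\<And>v. v \<in> W \<Longrightarrow> (\<psi>' has_derivative blinfun_apply (\<psi>'' v)) (at v)"
    and \<psi>'': "continuous_on W \<psi>''"
    using C2(2) unfolding C2_on_def by meson
  have inv: "\<phi> (\<psi> v) = v" "\<psi> v \<in> V" if "v \<in> W" for v
    using hom that by (auto simp: homeomorphism_def)
  have \<psi>N: "\<psi> v \<in> N" if "v \<in> L \<inter> W" for v
    using that NL hom by (smt (verit, best) Int_iff homeomorphism_apply1 imageE)
  have \<psi>'_inj: "w = 0" if v: "v \<in> W" and w: "\<psi>' v w = 0" for v w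
  proof -
    have "((\<lambda>v. \<phi> (\<psi> v)) has_derivative (\<lambda>w. \<phi>' (\<psi> v) (\<psi>' v w))) (at v)"
      by (rule has_derivative_compose[OF \<psi>[OF v] \<phi>[OF inv(2)[OF v]]])
    then have "((\<lambda>v. v) has_derivative (\<lambda>w. \<phi>' (\<psi> v) (\<psi>' v w))) (at v)"
      by (rule has_derivative_transform_within_open[OF _ open_VW(2) v]) (simp add: inv)
    then have "(\<lambda>w. \<phi>' (\<psi> v) (\<psi>' v w)) = (\<lambda>w. w)"
      using has_derivative_unique has_derivative_ident by blast
    then have "\<phi>' (\<psi> v) (\<psi>' v w) = w"
      by meson
    then show ?thesis
      using w by (simp add: blinfun.bilinear_simps)
  qed
  obtain P :: "'a \<Rightarrow> 'a" where P: "linear P" "\<And>v. P v \<in> L" "\<And>v. v \<in> L \<Longrightarrow> P v = v"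
    using linear_exists_left_inverse_on[OF linear_ident L] by (auto simp: image_subset_iff)
  note P_simps = linear_add[OF P(1)] linear_diff[OF P(1)] linear_scale[OF P(1)]

  have contS: "continuous_on ?S ?p"
    using continuous_on_nearest continuous_on_subset by blast
  define X where "X = ?S \<inter> ?p -` V"
  have X: "open X" "x0 \<in> X" "X \<subseteq> ?S"
    unfolding X_def using contS open_unique_closest_domain_Diff open_VW(1) V x0
    by (auto intro: continuous_open_preimage)
  define u where "u x = \<phi> (?p x)" for x
  have cont_p: "continuous_on X ?p"
    using contS X(3) continuous_on_subset by blast
  have u: "u x \<in> L \<inter> W" "\<psi> (u x) = ?p x" if "x \<in> X" for x
    using that NL hom nearest_in unfolding u_def X_def by (auto simp: homeomorphism_def)
  have cont_u: "continuous_on X u"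
    unfolding u_def using hom cont_p
    by (auto simp: homeomorphism_def X_def intro!: continuous_on_compose2[of V \<phi>])

  have first: "(x - \<psi> (u x)) \<bullet> \<psi>' (u x) w = 0" if "x \<in> X" "w \<in> L" for x w
    using that X(3) u[OF that(1)] closest_point_in_nearest[of x N]
    by (intro closest_point_parametrized(1)[OF open_VW(2) L \<psi> \<psi>' \<psi>N]) auto
  have second: "(x - \<psi> (u x)) \<bullet> \<psi>'' (u x) w w < \<psi>' (u x) w \<bullet> \<psi>' (u x) w"
    if x: "x \<in> X" and w: "w \<in> L" "w \<noteq> 0" for x w
  proof -
    let ?y = "\<psi> (u x)"
    obtain s where s: "1 < s" "closest_point_in N (?y + s *\<^sub>R (x - ?y)) ?y"
      using nearest_of_beyond[of x N] x X(3) u(2)[OF x] by auto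
    have "(?y + s *\<^sub>R (x - ?y) - ?y) \<bullet> \<psi>'' (u x) w w \<le> \<psi>' (u x) w \<bullet> \<psi>' (u x) w"
      by (rule closest_point_parametrized(2)[OF open_VW(2) L \<psi> \<psi>' \<psi>N u(1)[OF x] s(2) w(1)])
    then have 1: "s * ((x - ?y) \<bullet> \<psi>'' (u x) w w) \<le> \<psi>' (u x) w \<bullet> \<psi>' (u x) w"
      by simp
    have 2: "0 < \<psi>' (u x) w \<bullet> \<psi>' (u x) w"
      using \<psi>'_inj[of "u x" w] u(1)[OF x] w(2) by auto
    show ?thesis
    proof (cases "0 < (x - ?y) \<bullet> \<psi>'' (u x) w w")
      case True
      then have "1 * ((x - ?y) \<bullet> \<psi>'' (u x) w w) < s * ((x - ?y) \<bullet> \<psi>'' (u x) w w)"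
        using s(1) by (intro mult_strict_right_mono)
      then show ?thesis
        using 1 by simp
    qed (use 2 in linarith)
  qed

  (* For v in L and an orthogonal projection P, the sum over Basis is minus the gradient along L of
     (norm (x - psi v))^2 / 2. The summand v - P v vanishes on L and complements it, so that G = 0 is
     an equation on the whole space with an invertible derivative in v. *)
  define G where "G z = (\<Sum>b\<in>Basis. ((fst z - \<psi> (snd z)) \<bullet> \<psi>' (snd z) (P b)) *\<^sub>R b) + (snd z - P (snd z))"
    for z :: "'a \<times> 'a"
  define Af where "Af x w = (\<Sum>b\<in>Basis. ((x - \<psi> (u x)) \<bullet> \<psi>'' (u x) w (P b)
      - \<psi>' (u x) w \<bullet> \<psi>' (u x) (P b)) *\<^sub>R b) + (w - P w)" for x w
  define Bf where "Bf x h = (\<Sum>b\<in>Basis. (h \<bullet> \<psi>' (u x) (P b)) *\<^sub>R b)" for x h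
  have "linear (Af x)" for x
    unfolding Af_def
    by (rule linearI) (simp_all add: blinfun.bilinear_simps P_simps inner_add_left inner_add_right
        sum.distrib[symmetric] scaleR_sum_right algebra_simps)
  then have Af: "bounded_linear (Af x)" for x
    by (simp add: linear_conv_bounded_linear)
  have "linear (Bf x)" for x
    unfolding Bf_def
    by (rule linearI) (simp_all add: inner_add_left sum.distrib[symmetric] scaleR_sum_right algebra_simps)
  then have Bf: "bounded_linear (Bf x)" for x
    by (simp add: linear_conv_bounded_linear)
  define A where "A x = Blinfun (Af x)" for x
  define B where "B x = Blinfun (Bf x)" for x
  have A: "A x w = Af x w" and B: "B x w = Bf x w" for x w
    by (simp_all add: A_def B_def bounded_linear_Blinfun_apply Af Bf)
  have dG: "(G has_derivative (\<lambda>z. B x (fst z) + A x (snd z))) (at (x, u x))" if x: "x \<in> X" for x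
  proof -
    have uW: "u x \<in> W"
      using u(1)[OF x] by simp
    have 1: "((\<lambda>z. \<psi> (snd z)) has_derivative (\<lambda>z. \<psi>' (u x) (snd z))) (at (x, u x))"
      by (rule has_derivative_compose[OF has_derivative_snd[OF has_derivative_ident]]) (simp add: \<psi> uW)
    have "((\<lambda>z. \<psi>' (snd z)) has_derivative (\<lambda>z. \<psi>'' (u x) (snd z))) (at (x, u x))"
      by (rule has_derivative_compose[OF has_derivative_snd[OF has_derivative_ident]]) (simp add: \<psi>' uW)
    then have 2: "((\<lambda>z. \<psi>' (snd z) c) has_derivative (\<lambda>z. \<psi>'' (u x) (snd z) c)) (at (x, u x))" for c
      by (rule bounded_linear.has_derivative[OF blinfun.bounded_linear_left])
    have 3: "((\<lambda>z. P (snd z)) has_derivative (\<lambda>z. P (snd z))) (at (x, u x))"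
      using P(1) by (intro bounded_linear_imp_has_derivative bounded_linear_compose[OF _ bounded_linear_snd])
        (simp add: linear_conv_bounded_linear)
    show ?thesis
      unfolding G_def
      by (rule derivative_eq_intros 1 2 3 refl)+
         (simp add: fun_eq_iff A B Af_def Bf_def sum.distrib[symmetric] algebra_simps inner_diff_left)
  qed
  have G0: "G (x, u x) = 0" if "x \<in> X" for x
    using first[OF that P(2)] u(1)[OF that] P(3) by (simp add: G_def)
  have A_inj: "w = 0" if x: "x \<in> X" and w: "A x w = 0" for x w
  proof -
    have Af_inner: "Af x w \<bullet> c = ((x - \<psi> (u x)) \<bullet> \<psi>'' (u x) w (P c) - \<psi>' (u x) w \<bullet> \<psi>' (u x) (P c))
        + (w - P w) \<bullet> c" for c
    proof -
      have lin: "linear (\<lambda>c. (x - \<psi> (u x)) \<bullet> \<psi>'' (u x) w (P c) - \<psi>' (u x) w \<bullet> \<psi>' (u x) (P c))"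
        by (rule linearI) (simp_all add: blinfun.bilinear_simps P_simps algebra_simps inner_add_right)
      let ?l = "\<lambda>c. (x - \<psi> (u x)) \<bullet> \<psi>'' (u x) w (P c) - \<psi>' (u x) w \<bullet> \<psi>' (u x) (P c)"
      have "?l c = ?l (\<Sum>b\<in>Basis. (c \<bullet> b) *\<^sub>R b)"
        by (simp only: euclidean_representation)
      also have "\<dots> = (\<Sum>b\<in>Basis. (c \<bullet> b) * ?l b)"
        using linear_sum[OF lin, of "\<lambda>b. (c \<bullet> b) *\<^sub>R b" Basis] linear_scale[OF lin] by simp
      also have "\<dots> = (\<Sum>b\<in>Basis. ?l b *\<^sub>R b) \<bullet> c"
        by (simp add: inner_sum_left inner_commute[of c] mult.commute)
      finally have "(\<Sum>b\<in>Basis. ?l b *\<^sub>R b) \<bullet> c = ?l c"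
        by (rule sym)
      then show ?thesis
        unfolding Af_def by (simp add: inner_add_left)
    qed
    have w0: "Af x w \<bullet> c = 0" for c
      using w A by simp
    (* Pairing with w - P w, which P kills, puts w into L; there the strict second order condition
       applies. *)
    have "P (w - P w) = 0"
      using P by (simp add: P_simps)
    then have "(w - P w) \<bullet> (w - P w) = 0"
      using w0[of "w - P w"] unfolding Af_inner by (simp add: blinfun.bilinear_simps)
    then have wP: "P w = w"
      by simp
    then have "w \<in> L"
      using P(2)[of w] by simp
    moreover have "(x - \<psi> (u x)) \<bullet> \<psi>'' (u x) w w = \<psi>' (u x) w \<bullet> \<psi>' (u x) w"
      using w0[of w] unfolding Af_inner wP by simp
    ultimately show ?thesis
      using second[OF x, of w] by auto
  qed
  have "\<exists>D. (u has_derivative blinfun_apply D) (at x) \<and> A x o\<^sub>L D = - B x" if x: "x \<in> X" for x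
  proof -
    have "isCont u x"
      using cont_u x X(1) continuous_on_eq_continuous_at by blast
    moreover have "\<forall>\<^sub>F y in at x. G (y, u y) = 0"
      using eventually_at_in_open'[OF X(1) x] by eventually_elim (rule G0)
    ultimately obtain D where "(u has_derivative blinfun_apply D) (at x)" "A x o\<^sub>L D = - B x"
      using has_derivative_implicit[of G "B x" "A x" x u] dG[OF x] G0[OF x] A_inj[OF x] by metis
    then show ?thesis
      by blast
  qed
  then obtain Du where Du: "\<And>x. x \<in> X \<Longrightarrow> (u has_derivative blinfun_apply (Du x)) (at x)"
    "\<And>x. x \<in> X \<Longrightarrow> A x o\<^sub>L Du x = - B x"
    by metis
  have cont_\<psi>: "continuous_on X (\<lambda>x. \<psi> (u x))"
    using cont_p by (rule continuous_on_eq) (simp add: u(2))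
  have "continuous_on W \<psi>'"
    using \<psi>' by (meson continuous_at_imp_continuous_on has_derivative_continuous)
  then have cont_\<psi>': "continuous_on X (\<lambda>x. \<psi>' (u x))"
    using cont_u by (rule continuous_on_compose2) (use u(1) in auto)
  have cont_\<psi>'': "continuous_on X (\<lambda>x. \<psi>'' (u x))"
    using \<psi>'' cont_u by (rule continuous_on_compose2) (use u(1) in auto)
  have "continuous_on X A"
    by (rule continuous_on_blinfun_componentwise)
       (auto simp: A Af_def intro!: continuous_intros cont_\<psi> cont_\<psi>' cont_\<psi>'')
  moreover have "continuous_on X (\<lambda>x. - B x)"
    by (rule continuous_on_blinfun_componentwise)
       (auto simp: B Bf_def blinfun.bilinear_simps intro!: continuous_intros cont_\<psi>')
  ultimately have cont_Du: "continuous_on X Du"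
    by (rule continuous_on_blinfun_quotient) (use A_inj Du(2) in auto)
  show thesis
  proof (rule that[OF X(1,2)])
    show "(?p has_derivative blinfun_apply (\<psi>' (u x) o\<^sub>L Du x)) (at x)" if x: "x \<in> X" for x
    proof -
      have "((\<lambda>x. \<psi> (u x)) has_derivative (\<lambda>h. \<psi>' (u x) (Du x h))) (at x)"
        using has_derivative_compose[OF Du(1)[OF x] \<psi>] u(1)[OF x] by blast
      then have "(?p has_derivative (\<lambda>h. \<psi>' (u x) (Du x h))) (at x)"
        by (rule has_derivative_transform_within_open[OF _ X(1) x]) (simp add: u(2))
      then show ?thesis
        by (simp add: blinfun_compose.rep_eq comp_def)
    qed
    show "continuous_on X (\<lambda>x. \<psi>' (u x) o\<^sub>L Du x)"
      by (intro continuous_intros cont_\<psi>' cont_Du)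
  qed
qed

lemma nearest_C1:
  fixes N :: "'a::euclidean_space set"
  assumes N: "C2_submanifold k N"
  obtains D where
    "\<And>x. x \<in> unique_closest_domain N - N \<Longrightarrow> (nearest N has_derivative blinfun_apply (D x)) (at x)"
    "continuous_on (unique_closest_domain N - N) D"
proof -
  let ?S = "unique_closest_domain N - N"
  define D where "D x = Blinfun (frechet_derivative (nearest N) (at x))" for x
  have D_eq: "D x = E" if "(nearest N has_derivative blinfun_apply E) (at x)" for x E
    by (simp add: D_def blinfun_apply_inverse flip: frechet_derivative_at[OF that])
  have "(nearest N has_derivative blinfun_apply (D x)) (at x) \<and> isCont D x" if x: "x \<in> ?S" for x
  proof -
    obtain X E where X: "open X" "x \<in> X" and E: "continuous_on X E"
      "\<And>y. y \<in> X \<Longrightarrow> (nearest N has_derivative blinfun_apply (E y)) (at y)"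
      using nearest_locally_C1[OF N x] by metis
    have "continuous_on X D"
      using E(1) by (rule continuous_on_eq) (simp add: D_eq[OF E(2)])
    then show ?thesis
      using X E(2)[OF X(2)] D_eq[OF E(2)[OF X(2)]] continuous_on_eq_continuous_at by metis
  qed
  then show thesis
    using that[of D] by (simp add: continuous_at_imp_continuous_on)
qed

section \<open>Convexity along geodesics of a conformal metric\<close>

text \<open>The interval may contain its endpoints, where a geodesic has only one-sided derivatives, so the derivatives are
  taken within the interval.\<close>

lemma convex_on_of_second_derivative_nonneg:
  fixes F F' F'' :: "real \<Rightarrow> real"
  assumes I: "is_interval I"
    and F: "\<And>t. t \<in> I \<Longrightarrow> (F has_real_derivative F' t) (at t within I)"
    and F': "\<And>t. t \<in> I \<Longrightarrow> (F' has_real_derivative F'' t) (at t within I)"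
    and nonneg: "\<And>t. t \<in> I \<Longrightarrow> 0 \<le> F'' t"
  shows "convex_on I F"
proof (rule pos_convex_function)
  have mvt: "\<exists>\<xi>\<in>I. a < \<xi> \<and> \<xi> < b \<and> H b - H a = H' \<xi> * (b - a)"
    if ab: "a \<in> I" "b \<in> I" "a < b" and H: "\<And>t. t \<in> I \<Longrightarrow> (H has_real_derivative H' t) (at t within I)"
    for a b and H H' :: "real \<Rightarrow> real"
  proof -
    have sub: "{a..b} \<subseteq> I"
      using I ab(1,2) unfolding is_interval_1 by (meson atLeastAtMost_iff subsetI)
    have "(H has_derivative (*) (H' t)) (at t within {a..b})" if "a \<le> t" "t \<le> b" for t
      using H[of t] sub that unfolding has_field_derivative_def
      by (meson atLeastAtMost_iff has_derivative_subset subsetD)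
    then have "\<exists>\<xi>\<in>{a<..<b}. H b - H a = H' \<xi> * (b - a)"
      by (rule mvt_simple[OF ab(3)])
    then show ?thesis
      using sub by force
  qed
  show "convex I"
    using I is_interval_convex by blast
  have mono: "F' a \<le> F' b" if ab: "a \<in> I" "b \<in> I" "a < b" for a b
  proof -
    obtain \<xi> where "\<xi> \<in> I" "F' b - F' a = F'' \<xi> * (b - a)"
      using mvt[OF ab F'] by blast
    then have "0 \<le> F' b - F' a"
      using nonneg ab(3) by simp
    then show ?thesis
      by simp
  qed
  fix x y
  assume xy: "x \<in> I" "y \<in> I"
  consider "x < y" | "x = y" | "y < x"
    by linarith
  then show "F' x * (y - x) \<le> F y - F x"
  proof cases
    case 1
    obtain \<xi> where \<xi>: "\<xi> \<in> I" "x < \<xi>" "F y - F x = F' \<xi> * (y - x)"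
      using mvt[OF xy 1 F] by blast
    then show ?thesis
      using mono[OF xy(1) \<xi>(1,2)] 1 by (simp add: mult_right_mono)
  next
    case 3
    obtain \<xi> where \<xi>: "\<xi> \<in> I" "\<xi> < x" "F x - F y = F' \<xi> * (x - y)"
      using mvt[OF xy(2,1) 3 F] by blast
    then have "F x - F y \<le> F' x * (x - y)"
      using mono[OF \<xi>(1) xy(1) \<xi>(2)] 3 by (simp add: mult_right_mono)
    then show ?thesis
      by (simp add: algebra_simps)
  qed simp
qed

text \<open>Let \<open>f\<close> have gradient \<open>2 z\<close> and satisfy \<open>f = z \<bullet> z\<close>, so that
  \<open>\<surd>f\<close> has a gradient of norm 1. Pairing the geodesic equation of the metric
  \<open>1 / f\<close> with \<open>z\<close> gives
  \<open>z \<bullet> \<gamma>'' = 2 (z \<bullet> \<gamma>')\<^sup>2 / f - \<gamma>' \<bullet> \<gamma>'\<close>.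
  Inserting this into the second derivative of \<open>- ln f\<close> along \<open>\<gamma>\<close> cancels
  every term except
  \<open>2 (\<gamma>' \<bullet> \<gamma>' - E \<gamma>' \<bullet> \<gamma>') / f\<close>, where
  \<open>E\<close> is the derivative of \<open>z\<close>.\<close>

lemma convex_along_conformal_geodesic:
  fixes f :: "'a::euclidean_space \<Rightarrow> real" and z :: "'a \<Rightarrow> 'a" and E :: "'a \<Rightarrow> 'a \<Rightarrow> 'a"
  assumes f: "\<And>x. x \<in> S \<Longrightarrow> (f has_derivative (\<lambda>h. 2 * (z x \<bullet> h))) (at x)"
    and z: "\<And>x. x \<in> S \<Longrightarrow> (z has_derivative E x) (at x)"
    and fz: "\<And>x. x \<in> S \<Longrightarrow> f x = z x \<bullet> z x" and pos: "\<And>x. x \<in> S \<Longrightarrow> 0 < f x"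
    and E: "\<And>x v. x \<in> S \<Longrightarrow> E x v \<bullet> v \<le> v \<bullet> v"
    and geo: "geodesic_on S (\<lambda>x u v. 1 / f x * (u \<bullet> v)) I \<gamma>"
  shows "convex_on I (\<lambda>t. ln (1 / f (\<gamma> t)))"
proof -
  let ?g = "\<lambda>x u v. 1 / f x * (u \<bullet> v)"
  have I: "is_interval I" and S: "\<And>t. t \<in> I \<Longrightarrow> \<gamma> t \<in> S"
    using geo unfolding geodesic_on_def by auto
  obtain \<gamma>' \<gamma>'' where \<gamma>: "\<And>t. t \<in> I \<Longrightarrow> (\<gamma> has_vector_derivative \<gamma>' t) (at t within I)"
    and \<gamma>': "\<And>t. t \<in> I \<Longrightarrow> (\<gamma>' has_vector_derivative \<gamma>'' t) (at t within I)"
    and eq: "\<And>t w. t \<in> I \<Longrightarrow> ?g (\<gamma> t) (\<gamma>'' t) w + christoffel_first ?g (\<gamma> t) (\<gamma>' t) (\<gamma>' t) w = 0"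
    using geo unfolding geodesic_on_def by meson
  have dg: "frechet_derivative (\<lambda>x. ?g x v w) (at x) u = - 2 / (f x)\<^sup>2 * (z x \<bullet> u) * (v \<bullet> w)"
    if x: "x \<in> S" for x u v w
  proof -
    have "((\<lambda>x. ?g x v w) has_derivative (\<lambda>u. - 2 / (f x)\<^sup>2 * (z x \<bullet> u) * (v \<bullet> w))) (at x)"
      by (rule derivative_eq_intros f[OF x] refl | simp add: pos[OF x, THEN less_imp_neq, symmetric])+
         (simp add: fun_eq_iff power2_eq_square)
    then show ?thesis
      by (simp add: frechet_derivative_at[symmetric])
  qed
  define v b \<phi> q where "v = \<gamma>'" and "b t = z (\<gamma> t)" and "\<phi> t = f (\<gamma> t)" and "q t = z (\<gamma> t) \<bullet> \<gamma>' t" for t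
  have \<phi>pos: "0 < \<phi> t" if "t \<in> I" for t
    using pos[OF S[OF that]] by (simp add: \<phi>_def)
  have normal_acceleration: "b t \<bullet> \<gamma>'' t = 2 * (q t)\<^sup>2 / \<phi> t - v t \<bullet> v t" if t: "t \<in> I" for t
  proof -
    have "1 / \<phi> t * (b t \<bullet> \<gamma>'' t) + (2 * (- 2 / (\<phi> t)\<^sup>2 * q t * q t)
        - (- 2 / (\<phi> t)\<^sup>2 * \<phi> t * (v t \<bullet> v t))) / 2 = 0"
      using eq[OF t, of "b t", unfolded christoffel_first_def dg[OF S[OF t]]] fz[OF S[OF t]]
      by (simp add: b_def \<phi>_def q_def v_def inner_commute)
    then show ?thesis
      using \<phi>pos[OF t] by (simp add: field_simps power2_eq_square)
  qed
  have d\<gamma>: "(\<gamma> has_derivative (\<lambda>s. s *\<^sub>R v t)) (at t within I)"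
    and d\<gamma>': "(\<gamma>' has_derivative (\<lambda>s. s *\<^sub>R \<gamma>'' t)) (at t within I)" if "t \<in> I" for t
    using \<gamma>[OF that] \<gamma>'[OF that] by (simp_all add: has_vector_derivative_def v_def)
  have d\<phi>: "(\<phi> has_real_derivative 2 * q t) (at t within I)" if t: "t \<in> I" for t
    unfolding has_field_derivative_def \<phi>_def[abs_def]
    by (rule has_derivative_eq_rhs[OF has_derivative_compose[OF d\<gamma>[OF t] f[OF S[OF t]]]])
       (simp add: fun_eq_iff q_def v_def)
  have db: "(b has_derivative (\<lambda>s. s *\<^sub>R E (\<gamma> t) (v t))) (at t within I)" if t: "t \<in> I" for t
    using has_derivative_compose[OF d\<gamma>[OF t] z[OF S[OF t]]] has_derivative_linear[OF z[OF S[OF t]]]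
    by (simp add: b_def[abs_def] linear_scale)
  have dq: "(q has_real_derivative (b t \<bullet> \<gamma>'' t + E (\<gamma> t) (v t) \<bullet> v t)) (at t within I)" if t: "t \<in> I" for t
    unfolding has_field_derivative_def q_def[abs_def] b_def[symmetric]
    by (rule has_derivative_eq_rhs[OF has_derivative_inner[OF db[OF t] d\<gamma>'[OF t]]])
       (simp add: fun_eq_iff v_def algebra_simps)
  show ?thesis
  proof (rule convex_on_of_second_derivative_nonneg[OF I])
    fix t
    assume t: "t \<in> I"
    show "((\<lambda>t. ln (1 / f (\<gamma> t))) has_real_derivative - 2 * q t / \<phi> t) (at t within I)"
      unfolding \<phi>_def[symmetric]
      by (rule derivative_eq_intros d\<phi>[OF t] refl | simp add: \<phi>pos[OF t] \<phi>pos[OF t, THEN less_imp_neq, symmetric])+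
    have "((\<lambda>t. - 2 * q t / \<phi> t) has_real_derivative
        (- 2 * (b t \<bullet> \<gamma>'' t + E (\<gamma> t) (v t) \<bullet> v t) * \<phi> t - (- 2 * q t) * (2 * q t)) / (\<phi> t * \<phi> t)) (at t within I)"
      using \<phi>pos[OF t] by (intro DERIV_divide DERIV_cmult dq d\<phi> t) simp
    also have "(- 2 * (b t \<bullet> \<gamma>'' t + E (\<gamma> t) (v t) \<bullet> v t) * \<phi> t - (- 2 * q t) * (2 * q t)) / (\<phi> t * \<phi> t)
        = 2 * (v t \<bullet> v t - E (\<gamma> t) (v t) \<bullet> v t) / \<phi> t"
      unfolding normal_acceleration[OF t] using \<phi>pos[OF t] by (simp add: field_simps power2_eq_square)
    finally show "((\<lambda>t. - 2 * q t / \<phi> t) has_real_derivative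
        2 * (v t \<bullet> v t - E (\<gamma> t) (v t) \<bullet> v t) / \<phi> t) (at t within I)" .
    show "0 \<le> 2 * (v t \<bullet> v t - E (\<gamma> t) (v t) \<bullet> v t) / \<phi> t"
      using E[OF S[OF t]] \<phi>pos[OF t] by simp
  qed
qed

section \<open>Self-convexity of the inverse squared distance\<close>

lemma monotone_derivative_nonneg:
  fixes p :: "'a::real_inner \<Rightarrow> 'a"
  assumes p: "(p has_derivative D) (at x)"
    and mono: "\<forall>\<^sub>F y in nhds x. 0 \<le> (y - x) \<bullet> (p y - p x)"
  shows "0 \<le> D v \<bullet> v"
proof (rule ccontr)
  assume neg: "\<not> 0 \<le> D v \<bullet> v"
  define m where "m s = (p (x + s *\<^sub>R v) - p x) \<bullet> v" for s :: real
  have l: "((\<lambda>s. x + s *\<^sub>R v) has_derivative (\<lambda>s. s *\<^sub>R v)) (at 0)"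
    by (auto intro!: derivative_eq_intros)
  then have "((\<lambda>s. x + s *\<^sub>R v) \<longlongrightarrow> x + 0 *\<^sub>R v) (at 0)"
    using has_derivative_continuous isCont_def by blast
  then have "((\<lambda>s. x + s *\<^sub>R v) \<longlongrightarrow> x + 0 *\<^sub>R v) (nhds 0)"
    by (rule tendsto_at_iff_tendsto_nhds[THEN iffD1])
  then have "filterlim (\<lambda>s. x + s *\<^sub>R v) (nhds x) (nhds 0)"
    by simp
  then have ev: "\<forall>\<^sub>F s in nhds 0. 0 \<le> (x + s *\<^sub>R v - x) \<bullet> (p (x + s *\<^sub>R v) - p x)"
    by (rule eventually_compose_filterlim[OF mono])
  have "((\<lambda>s. p (x + s *\<^sub>R v)) has_derivative (\<lambda>s. D (s *\<^sub>R v))) (at 0)"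
    using p by (intro has_derivative_compose[OF l]) simp
  then have "((\<lambda>s. p (x + s *\<^sub>R v)) has_derivative (\<lambda>s. s *\<^sub>R D v)) (at 0)"
    using has_derivative_linear[OF p] by (simp add: linear_scale)
  then have "(m has_real_derivative D v \<bullet> v) (at 0)"
    unfolding m_def has_field_derivative_def
    by (auto intro!: derivative_eq_intros simp: fun_eq_iff)
  then obtain d where d: "0 < d" "\<And>h. 0 < h \<Longrightarrow> h < d \<Longrightarrow> m h < m 0"
    using DERIV_neg_dec_right[of m "D v \<bullet> v" 0] neg by auto
  obtain e where e: "0 < e" "\<And>s. dist s 0 < e \<Longrightarrow> 0 \<le> (x + s *\<^sub>R v - x) \<bullet> (p (x + s *\<^sub>R v) - p x)"
    using ev unfolding eventually_nhds_metric by blast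
  define h where "h = min d e / 2"
  have h: "0 < h" "h < d" "h < e"
    using d(1) e(1) by (auto simp: h_def min_def)
  have "m h < 0"
    using d(2)[OF h(1,2)] by (simp add: m_def)
  moreover have "0 \<le> h * m h"
    using e(2)[of h] h by (simp add: m_def inner_commute)
  ultimately show False
    using h(1) by (simp add: zero_le_mult_iff)
qed

text \<open>Here \<open>f\<close> has the gradient \<open>2 z\<close>, as the squared distance does with
  \<open>z x = x - nearest N x\<close>.\<close>

lemma C2_on_inverse_of_gradient:
  fixes f :: "'a::euclidean_space \<Rightarrow> real" and z :: "'a \<Rightarrow> 'a" and D :: "'a \<Rightarrow> 'a \<Rightarrow>\<^sub>L 'a"
  assumes f: "\<And>x. x \<in> S \<Longrightarrow> (f has_derivative (\<lambda>h. 2 * (z x \<bullet> h))) (at x)"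
    and z: "\<And>x. x \<in> S \<Longrightarrow> (z has_derivative blinfun_apply (D x)) (at x)"
    and D: "continuous_on S D" and pos: "\<And>x. x \<in> S \<Longrightarrow> f x \<noteq> 0"
  shows "C2_on S (\<lambda>x. 1 / f x)"
proof -
  let ?R = "blinfun_inner_right :: 'a \<Rightarrow> 'a \<Rightarrow>\<^sub>L real"
  have R: "Blinfun ?R h = ?R h" for h
    by (simp add: bounded_linear_Blinfun_apply bounded_linear_blinfun_inner_right)
  define a' where "a' x = (- 2 / (f x)\<^sup>2) *\<^sub>R ?R (z x)" for x
  define a'' where "a'' x = (- 2 / (f x)\<^sup>2) *\<^sub>R (Blinfun ?R o\<^sub>L D x)
      + (8 / (f x) ^ 3) *\<^sub>R (blinfun_scaleR_left (?R (z x)) o\<^sub>L ?R (z x))" for x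
  have "((\<lambda>x. 1 / f x) has_derivative blinfun_apply (a' x)) (at x)" if x: "x \<in> S" for x
    by (rule derivative_eq_intros f[OF x] refl pos[OF x])+
       (simp add: fun_eq_iff a'_def blinfun.bilinear_simps power2_eq_square)
  moreover have "(a' has_derivative blinfun_apply (a'' x)) (at x)" if x: "x \<in> S" for x
  proof -
    have 1: "((\<lambda>x. ?R (z x)) has_derivative (\<lambda>h. ?R (D x h))) (at x)"
      by (rule bounded_linear.has_derivative[OF bounded_linear_blinfun_inner_right z[OF x]])
    have 2: "((\<lambda>x. - 2 / (f x)\<^sup>2) has_derivative (\<lambda>h. 8 / (f x) ^ 3 * (z x \<bullet> h))) (at x)"
      by (rule derivative_eq_intros f[OF x] refl | simp add: pos[OF x])+
         (simp add: fun_eq_iff pos[OF x] field_simps power_numeral_reduce)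
    have "((\<lambda>x. (- 2 / (f x)\<^sup>2) *\<^sub>R ?R (z x)) has_derivative
        (\<lambda>h. (- 2 / (f x)\<^sup>2) *\<^sub>R ?R (D x h) + (8 / (f x) ^ 3 * (z x \<bullet> h)) *\<^sub>R ?R (z x))) (at x)"
      by (rule has_derivative_scaleR[OF 2 1])
    also have "(\<lambda>h. (- 2 / (f x)\<^sup>2) *\<^sub>R ?R (D x h) + (8 / (f x) ^ 3 * (z x \<bullet> h)) *\<^sub>R ?R (z x)) = a'' x"
      by (simp add: fun_eq_iff a''_def blinfun.bilinear_simps R)
    finally show ?thesis
      unfolding a'_def .
  qed
  moreover have "continuous_on S f" "continuous_on S z"
    using f z by (meson continuous_at_imp_continuous_on has_derivative_continuous)+
  then have "continuous_on S a''"
    unfolding a''_def using pos D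
    by (intro continuous_intros bounded_linear.continuous_on[OF bounded_linear_blinfun_inner_right]
        bounded_linear.continuous_on[OF bounded_linear_blinfun_scaleR_left]) auto
  ultimately show ?thesis
    unfolding C2_on_def by blast
qed

lemma C2_on_const: "C2_on S (\<lambda>x. c)"
  unfolding C2_on_def by (intro exI[of _ "\<lambda>x. 0"]) (auto simp: zero_blinfun.rep_eq[abs_def])

lemma riemannian_metric_on_inner: "riemannian_metric_on S (\<lambda>x u v. u \<bullet> v)"
  unfolding riemannian_metric_on_def
  by (auto simp: bilinear_def C2_on_const inner_commute inner_add_left inner_add_right intro!: linearI)

theorem theorem2:
  fixes N :: "(real ^ 'j) set" and k :: nat
  assumes "C2_submanifold k N"
  shows "self_convex (unique_closest_domain N - N) (\<lambda>x u v. u \<bullet> v) (\<lambda>x. 1 / (infdist x N)\<^sup>2)"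
proof -
  let ?S = "unique_closest_domain N - N"
  let ?f = "\<lambda>x. (infdist x N)\<^sup>2" and ?z = "\<lambda>x. x - nearest N x"
  obtain D where D: "\<And>x. x \<in> ?S \<Longrightarrow> (nearest N has_derivative blinfun_apply (D x)) (at x)"
    and cont_D: "continuous_on ?S D"
    using nearest_C1[OF assms] by blast
  have df: "(?f has_derivative (\<lambda>h. 2 * (?z x \<bullet> h))) (at x)" if "x \<in> ?S" for x
    using that by (intro has_derivative_infdist_power2) simp
  have dz: "(?z has_derivative blinfun_apply (id_blinfun - D x)) (at x)" if "x \<in> ?S" for x
    by (rule has_derivative_eq_rhs[OF has_derivative_diff[OF has_derivative_ident D[OF that]]])
       (simp add: fun_eq_iff blinfun.bilinear_simps)
  have fz: "?f x = ?z x \<bullet> ?z x" if "x \<in> ?S" for x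
    using that dist_nearest[of x N] by (simp add: dist_norm flip: power2_norm_eq_inner)
  have pos: "0 < ?f x" if "x \<in> ?S" for x
  proof -
    have "nearest N x \<noteq> x"
      using that nearest_in[of x N] by auto
    then show ?thesis
      unfolding fz[OF that] by simp
  qed
  have contraction: "(id_blinfun - D x) v \<bullet> v \<le> v \<bullet> v" if x: "x \<in> ?S" for x v
  proof -
    have "\<forall>\<^sub>F y in nhds x. y \<in> ?S"
      using open_unique_closest_domain_Diff x by (rule eventually_nhds_in_open)
    then have "\<forall>\<^sub>F y in nhds x. 0 \<le> (y - x) \<bullet> (nearest N y - nearest N x)"
      by eventually_elim (use nearest_monotone x in blast)
    then have "0 \<le> D x v \<bullet> v"
      by (rule monotone_derivative_nonneg[OF D[OF x]])
    then show ?thesis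
      by (simp add: blinfun.bilinear_simps inner_diff_left)
  qed
  have "C2_on ?S (\<lambda>x. 1 / ?f x)"
    using pos by (intro C2_on_inverse_of_gradient[OF df dz] continuous_intros cont_D) (auto dest: less_imp_neq)
  moreover have "convex_on I (\<lambda>t. ln (1 / ?f (\<gamma> t)))"
    if "geodesic_on ?S (\<lambda>x u v. 1 / ?f x * (u \<bullet> v)) I \<gamma>" for I \<gamma>
    by (rule convex_along_conformal_geodesic[OF df dz fz pos contraction that])
  ultimately show ?thesis
    unfolding self_convex_def
    using pos open_unique_closest_domain_Diff riemannian_metric_on_inner by auto
qed

end
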